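(* There is an absolute constant $c>0$ such that for every integer $k \geq 3$, \[ \limsup_{N\to\infty} \frac{\log F_k(N)}{\log N} \leq 1 - \frac{c}{\log\log k}. \]
   Context: For positive integers $k,N$, $F_k(N)$ denotes the size of the smallest set of integers containing, for each $d \in \{1,\dots,N\}$, a $k$-term arithmetic progression with common difference $d$. *)

theory Defs
  imports Complex_Main "HOL-Library.Extended_Real"
begin

definition arith_prog :: "nat \<Rightarrow> int \<Rightarrow> int \<Rightarrow> int set" where
  "arith_prog k a d = (\<lambda>i. a + int i * d) ` {..<k}"

definition has_all_progs :: "nat \<Rightarrow> nat \<Rightarrow> int set \<Rightarrow> bool" where
  "has_all_progs k N S \<longleftrightarrow> (\<forall>d\<in>{1..N}. \<exists>a. arith_prog k a (int d) \<subseteq> S)"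

(* finite S is needed because card is 0 on infinite sets. *)
definition F :: "nat \<Rightarrow> nat \<Rightarrow> nat" where
  "F k N = (LEAST m. \<exists>S. finite S \<and> card S = m \<and> has_all_progs k N S)"

(* The minimum in the definition of F is over a nonempty set, hence attained. *)
lemma F_attained: "\<exists>S. finite S \<and> card S = F k N \<and> has_all_progs k N S"
proof -
  let ?S = "\<Union>d\<in>{1..N}. arith_prog k 0 (int d)"
  have "finite ?S" by (simp add: arith_prog_def)
  moreover have "has_all_progs k N ?S" unfolding has_all_progs_def by blast
  ultimately have "\<exists>m S. finite S \<and> card S = m \<and> has_all_progs k N S" by blast
  then show ?thesis unfolding F_def by (rule LeastI_ex)
qed

end

(* Let M be the product of r odd primes, and let the progression of difference d start at d^2 mod M.
   For each i, completing the square in d^2 + i d shows that the terms with index i lie in a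
   translate of the squares modulo M, which number at most (2/3)^r M by the Chinese remainder
   theorem. Hence k^2 (2/3)^r M integers suffice for all differences below M, and
   treating differences digit by digit in base M turns this into a bound on the limsup. By a
   Chebyshev-type estimate the primes can be taken of size at most a power of log k while the factor
   (3/2)^(r/2) still exceeds k^2, so the exponent saved is of order r / log M, that is,
   1 / log log k. *)
theory Submission
  imports Defs "HOL-Number_Theory.Number_Theory"
begin

subsection \<open>Squares modulo an integer\<close>

definition squares_mod :: "nat \<Rightarrow> int set" where
  "squares_mod m = range (\<lambda>s. s\<^sup>2 mod int m)"

lemma squares_mod_subset: "m > 0 \<Longrightarrow> squares_mod m \<subseteq> {0..<int m}"
  by (auto simp: squares_mod_def)

lemma finite_squares_mod [simp]: "m > 0 \<Longrightarrow> finite (squares_mod m)"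
  by (rule finite_subset[OF squares_mod_subset]) auto

text \<open>Since \<open>u\<close> and \<open>m - u\<close> have the same square, the residues up to
  \<open>m div 2\<close> already produce every square.\<close>

lemma card_squares_mod_le:
  assumes "m > 0"
  shows "card (squares_mod m) \<le> m div 2 + 1"
proof -
  have "squares_mod m \<subseteq> (\<lambda>s. s\<^sup>2 mod int m) ` {0..int m div 2}"
  proof
    fix y assume "y \<in> squares_mod m"
    then obtain s where y: "y = s\<^sup>2 mod int m" by (auto simp: squares_mod_def)
    define u where "u = s mod int m"
    have u: "0 \<le> u" "u < int m" using assms by (auto simp: u_def)
    have yu: "y = u\<^sup>2 mod int m" by (simp add: y u_def power_mod)
    have "(int m - u)\<^sup>2 = u\<^sup>2 + int m * (int m - 2 * u)"
      by (simp add: power2_eq_square algebra_simps)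
    then have yu': "y = (int m - u)\<^sup>2 mod int m" by (simp add: yu)
    show "y \<in> (\<lambda>s. s\<^sup>2 mod int m) ` {0..int m div 2}"
    proof (cases "u \<le> int m div 2")
      case True
      then show ?thesis using u yu by auto
    next
      case False
      then have "int m - u \<in> {0..int m div 2}" using u by auto
      then show ?thesis using yu' by blast
    qed
  qed
  then have "card (squares_mod m) \<le> card {0..int m div 2}"
    by (meson card_image_le card_mono finite_atLeastAtMost_int finite_imageI le_trans)
  also have "\<dots> = m div 2 + 1" by (simp add: nat_add_distrib nat_div_distrib)
  finally show ?thesis .
qed

text \<open>Chinese remainder theorem: reducing modulo \<open>a\<close> and modulo \<open>b\<close>
  is injective on residues modulo \<open>a * b\<close> and sends squares to pairs of
  squares.\<close>

lemma card_squares_mod_mult_le: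
  assumes "coprime a b" "a > 0" "b > 0"
  shows "card (squares_mod (a * b)) \<le> card (squares_mod a) * card (squares_mod b)"
proof -
  let ?f = "\<lambda>y. (y mod int a, y mod int b)"
  have "inj_on ?f {0..<int (a * b)}"
  proof (rule inj_onI)
    fix x y assume xy: "x \<in> {0..<int (a * b)}" "y \<in> {0..<int (a * b)}" "?f x = ?f y"
    then have "[x = y] (mod int a)" "[x = y] (mod int b)" by (auto simp: cong_def)
    then have "[x = y] (mod int a * int b)"
      using assms(1) coprime_cong_mult by fastforce
    then show "x = y" using xy by (simp add: cong_def)
  qed
  then have "inj_on ?f (squares_mod (a * b))"
    using squares_mod_subset[of "a * b"] assms by (meson inj_on_subset mult_pos_pos)
  moreover have "?f ` squares_mod (a * b) \<subseteq> squares_mod a \<times> squares_mod b"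
    by (auto simp: squares_mod_def mod_mod_cancel)
  ultimately have "card (squares_mod (a * b)) \<le> card (squares_mod a \<times> squares_mod b)"
    using assms by (intro card_inj_on_le[of ?f]) auto
  then show ?thesis by (simp add: card_cartesian_product)
qed

text \<open>An odd prime \<open>p\<close> has at most \<open>(p + 1) / 2\<close> squares, which is
  at most \<open>2 * p / 3\<close> because \<open>p \<ge> 3\<close>. Multiplicativity gives the
  density \<open>(2/3) ^ card P\<close>, cleared of denominators here.\<close>

lemma card_squares_mod_prod_le:
  assumes "finite P" "\<And>p. p \<in> P \<Longrightarrow> prime p \<and> odd p"
  shows "3 ^ card P * card (squares_mod (\<Prod>P)) \<le> 2 ^ card P * \<Prod>P"
  using assms
proof (induction P rule: finite_induct)
  case empty
  show ?case using card_squares_mod_le[of 1] by simp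
next
  case (insert p P)
  have p: "prime p" "odd p" and P: "\<And>q. q \<in> P \<Longrightarrow> prime q" using insert.prems by auto
  have "p \<noteq> 2" using p by auto
  then have "p \<ge> 3" using prime_ge_2_nat[OF p(1)] by linarith
  then have one: "3 * card (squares_mod p) \<le> 2 * p"
    using card_squares_mod_le[of p] p(2) by (auto elim!: oddE)
  have "coprime p (\<Prod>P)"
    using insert.hyps p P by (intro prod_coprime_right) (metis primes_coprime)
  moreover have "\<Prod>P > 0" using P prime_gt_0_nat by (intro prod_pos) auto
  ultimately have "card (squares_mod (p * \<Prod>P)) \<le> card (squares_mod p) * card (squares_mod (\<Prod>P))"
    using \<open>p \<ge> 3\<close> by (intro card_squares_mod_mult_le) auto
  then have "3 * 3 ^ card P * card (squares_mod (p * \<Prod>P))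
      \<le> (3 * card (squares_mod p)) * (3 ^ card P * card (squares_mod (\<Prod>P)))"
    by (simp add: ac_simps)
  also have "\<dots> \<le> (2 * p) * (2 ^ card P * \<Prod>P)"
    using insert.prems by (intro mult_mono one insert.IH) auto
  finally show ?case using insert.hyps by (simp add: ac_simps)
qed

subsection \<open>Many small primes\<close>

text \<open>The induction is the recurrence of Leibniz's harmonic triangle,
  in which the entries are the reciprocals of \<open>Suc n * (n choose j)\<close>.\<close>
lemma Suc_times_binomial_dvd:
  assumes "j \<le> n" "\<And>m. 0 < m \<Longrightarrow> m \<le> Suc n \<Longrightarrow> m dvd D"
  shows "Suc n * (n choose j) dvd D"
proof -
  \<comment> \<open>Divisibility is recast as integrality of a quotient, since the recurrence writes
    each new quotient as a difference of two earlier ones.\<close>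
  have "real D / real (Suc n * (n choose j)) \<in> \<int>"
    using assms
  proof (induction j arbitrary: n)
    case 0
    then have "Suc n dvd D" by simp
    then have "real D / real (Suc n) = real (D div Suc n)" by (simp only: real_of_nat_div)
    then show ?case by simp
  next
    case (Suc j n')
    then obtain n where n: "n' = Suc n" "j \<le> n" by (cases n') auto
    define c where "c = real (n choose j)"
    have c: "c > 0" using n by (simp add: c_def)
    have e1: "real (j + 1) * real (Suc n choose Suc j) = real (n + 1) * c"
      unfolding c_def of_nat_mult[symmetric] Suc_eq_plus1[symmetric] by (simp only: Suc_times_binomial)
    have "(Suc n - j) * (Suc n choose j) = Suc n * (n choose j)"
      using binomial_absorb_comp[of "Suc n" j] by simp
    then have "real (Suc n - j) * real (Suc n choose j) = real (n + 1) * c"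
      unfolding c_def of_nat_mult[symmetric] Suc_eq_plus1[symmetric] by (simp only:)
    then have e2: "(real n + 1 - real j) * real (Suc n choose j) = real (n + 1) * c"
      using n by (simp add: of_nat_diff algebra_simps)
    \<comment> \<open>The three denominators in the recurrence are \<open>u\<close> divided by
      \<open>j + 1\<close>, by \<open>n + 1 - j\<close> and by \<open>n + 2\<close>, so the
      recurrence reduces to \<open>j + 1 = (n + 2) - (n + 1 - j)\<close>.\<close>
    define u where "u = real (n + 2) * (real (n + 1) * c)"
    have u: "u \<noteq> 0" using c by (simp add: u_def)
    have nj: "real n + 1 - real j > 0" using n by simp
    have "real (n + 2) * real (Suc n choose Suc j) = u / real (j + 1)"
      unfolding u_def e1[symmetric] by simp
    moreover have "real (n + 2) * real (Suc n choose j) = u / (real n + 1 - real j)"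
      unfolding u_def e2[symmetric] using nj by simp
    moreover have "real (n + 1) * c = u / real (n + 2)"
      unfolding u_def by simp
    moreover have "real (j + 1) / u = real (n + 2) / u - (real n + 1 - real j) / u"
      by (simp add: diff_divide_distrib[symmetric])
    ultimately have "1 / (real (n + 2) * real (Suc n choose Suc j))
        = 1 / (real (n + 1) * c) - 1 / (real (n + 2) * real (Suc n choose j))"
      by (simp only: divide_divide_eq_right mult_1)
    then have "real D * (1 / (real (n + 2) * real (Suc n choose Suc j)))
        = real D * (1 / (real (n + 1) * c)) - real D * (1 / (real (n + 2) * real (Suc n choose j)))"
      by (simp only: right_diff_distrib)
    then have eq: "real D / real (Suc (Suc n) * (Suc n choose Suc j))
        = real D / real (Suc n * (n choose j)) - real D / real (Suc (Suc n) * (Suc n choose j))"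
      by (simp only: c_def of_nat_mult Suc_eq_plus1 add.assoc one_add_one mult_1_right times_divide_eq_right)
    show ?case unfolding n eq
      using n Suc.prems by (intro Ints_diff Suc.IH) auto
  qed
  then obtain z where "real D / real (Suc n * (n choose j)) = of_int z"
    by (auto elim: Ints_cases)
  moreover have "Suc n * (n choose j) \<noteq> 0" using assms(1) by simp
  then have "real (Suc n * (n choose j)) \<noteq> 0" by (simp only: of_nat_eq_0_iff not_False_eq_True)
  ultimately have "real D = of_int z * real (Suc n * (n choose j))"
    by (metis nonzero_divide_eq_eq)
  then have "real_of_int (int D) = real_of_int (z * int (Suc n * (n choose j)))"
    by simp
  then have "int D = z * int (Suc n * (n choose j))"
    by (simp only: of_int_eq_iff)
  then have "int (Suc n * (n choose j)) dvd int D" by simp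
  then show ?thesis by (simp only: int_dvd_int_iff)
qed

text \<open>Each \<open>Suc n * (n choose j)\<close> divides \<open>D\<close> and so is at most
  \<open>D\<close>; summing over the \<open>n + 1\<close> values of \<open>j\<close> gives
  \<open>Suc n * 2 ^ n\<close> on the left and \<open>Suc n * D\<close> on the right.\<close>

lemma power_two_le_common_multiple:
  assumes "D > 0" "\<And>m. 0 < m \<Longrightarrow> m \<le> Suc n \<Longrightarrow> m dvd D"
  shows "2 ^ n \<le> D"
proof -
  have "Suc n * 2 ^ n = (\<Sum>j\<le>n. Suc n * (n choose j))"
    by (simp only: choose_row_sum sum_distrib_left[symmetric])
  also have "\<dots> \<le> (\<Sum>j\<le>n. D)"
  proof (rule sum_mono)
    fix j assume "j \<in> {..n}"
    then have "Suc n * (n choose j) dvd D" using assms(2) by (intro Suc_times_binomial_dvd) auto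
    then show "Suc n * (n choose j) \<le> D" using assms(1) by (rule dvd_imp_le)
  qed
  also have "\<dots> = Suc n * D" by simp
  finally show ?thesis using Suc_mult_le_cancel1 by blast
qed

text \<open>The least common multiple of \<open>1, ..., Suc n\<close> is at least
  \<open>2 ^ n\<close>, yet each prime contributes to it a power not exceeding
  \<open>Suc n\<close>.\<close>

lemma power_two_le_power_card_primes:
  "2 ^ n \<le> Suc n ^ card {p. prime p \<and> p \<le> Suc n}"
proof -
  define P where "P = {p. prime p \<and> p \<le> Suc n}"
  \<comment> \<open>With the largest exponent that occurs for each prime, \<open>D\<close> is the
    least common multiple.\<close>
  define e where "e p = Max (multiplicity p ` {1..Suc n})" for p
  define D where "D = (\<Prod>p\<in>P. p ^ e p)"
  have [simp]: "finite P" by (auto simp: P_def)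
  have "m dvd D" if m: "0 < m" "m \<le> Suc n" for m
  proof -
    have "m = (\<Prod>p\<in>prime_factors m. p ^ multiplicity p m)"
      using m by (simp add: prime_factorization_nat)
    also have "\<dots> dvd D" unfolding D_def
    proof (rule prod_dvd_prod_subset2)
      show "prime_factors m \<subseteq> P"
      proof
        fix p assume p: "p \<in> prime_factors m"
        then have "p \<le> m" using m by (intro dvd_imp_le in_prime_factors_imp_dvd) auto
        then show "p \<in> P" using p m by (auto simp: P_def)
      qed
      fix p assume "p \<in> prime_factors m"
      show "p ^ multiplicity p m dvd p ^ e p"
        using m by (intro le_imp_power_dvd) (auto simp: e_def intro!: Max_ge)
    qed auto
    finally show ?thesis .
  qed
  moreover have "D > 0" by (auto simp: D_def P_def prime_gt_0_nat intro!: prod_pos)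
  ultimately have "2 ^ n \<le> D" by (intro power_two_le_common_multiple) auto
  also have "D \<le> (\<Prod>p\<in>P. Suc n)" unfolding D_def
  proof (intro prod_mono conjI)
    fix p assume "p \<in> P"
    have "e p \<in> multiplicity p ` {1..Suc n}" unfolding e_def by (rule Max_in) auto
    then obtain m where "m \<in> {1..Suc n}" "e p = multiplicity p m" by auto
    then show "p ^ e p \<le> Suc n"
      using multiplicity_dvd[of p m] dvd_imp_le[of "p ^ e p" m] by auto
  qed auto
  also have "\<dots> = Suc n ^ card P" by simp
  finally show ?thesis by (simp add: P_def)
qed

text \<open>Comparing exponents of 2 in the previous bound at \<open>4 ^ t = 2 ^ (2 * t)\<close>
  yields at least \<open>2 ^ t\<close> primes. Giving up half of this more than pays for discarding
  the prime 2.\<close>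

lemma card_odd_primes_ge:
  assumes "t \<ge> 3"
  shows "2 ^ (t - 1) \<le> card {p. prime p \<and> odd p \<and> p \<le> (4::nat) ^ t}"
proof -
  define Q where "Q = {p. prime p \<and> p \<le> (4::nat) ^ t}"
  have "(2::nat) ^ (4 ^ t - 1) \<le> (4 ^ t) ^ card Q"
    using power_two_le_power_card_primes[of "4 ^ t - 1"] by (simp add: Q_def)
  also have "\<dots> = 2 ^ (2 * t * card Q)" by (simp add: power_mult)
  finally have "(2::nat) ^ (4 ^ t - 1) \<le> 2 ^ (2 * t * card Q)" .
  then have "4 ^ t - 1 \<le> 2 * t * card Q" by simp
  \<comment> \<open>This is where \<open>t \<ge> 3\<close> enters: at \<open>t = 2\<close> the
    inequality reads 16 \<le> 15.\<close>
  moreover have "2 * t * 2 ^ t \<le> (4::nat) ^ t - 1" using assms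
  proof (induction t rule: dec_induct)
    case (step s)
    have "2 * Suc s * 2 ^ Suc s \<le> 4 * (2 * s * 2 ^ s)" using step.hyps by simp
    also have "\<dots> \<le> 4 * (4 ^ s - 1)" using step.IH by simp
    also have "\<dots> \<le> 4 ^ Suc s - 1" by simp
    finally show ?case .
  qed simp
  ultimately have "2 * t * 2 ^ t \<le> 2 * t * card Q" by linarith
  then have "2 ^ t \<le> card Q" using assms by simp
  moreover have "card Q \<le> card {p. prime p \<and> odd p \<and> p \<le> (4::nat) ^ t} + 1"
  proof -
    have "Q \<subseteq> insert 2 {p. prime p \<and> odd p \<and> p \<le> (4::nat) ^ t}"
      using primes_dvd_imp_eq[OF two_is_prime_nat] unfolding Q_def by blast
    then have "card Q \<le> card (insert 2 {p. prime p \<and> odd p \<and> p \<le> (4::nat) ^ t})"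
      by (intro card_mono) auto
    then show ?thesis by (simp add: card_insert_if)
  qed
  moreover have "(2::nat) ^ t = 2 * 2 ^ (t - 1)" using assms by (cases t) auto
  moreover have "(1::nat) \<le> 2 ^ (t - 1)" by simp
  ultimately show ?thesis by linarith
qed

subsection \<open>Sets containing progressions of every difference\<close>

text \<open>The differences start at 0 and stop below \<open>B\<close>, so that they are exactly the
  digits in base \<open>B\<close>.\<close>

definition covers :: "nat \<Rightarrow> nat \<Rightarrow> int set \<Rightarrow> bool" where
  "covers k B S \<longleftrightarrow> (\<forall>d<B. \<exists>a. arith_prog k a (int d) \<subseteq> S)"

lemma covers_nonempty:
  assumes "covers k B S" "B > 0" "k > 0"
  shows "S \<noteq> {}"
proof -
  obtain a where "arith_prog k a (int 0) \<subseteq> S" using assms(1,2) unfolding covers_def by blast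
  then show ?thesis using assms(3) by (auto simp: arith_prog_def)
qed

lemma F_le_card:
  assumes "finite S" "covers k B S" "N < B"
  shows "F k N \<le> card S"
proof -
  have "has_all_progs k N S" using assms by (auto simp: has_all_progs_def covers_def)
  then show ?thesis unfolding F_def using assms by (intro Least_le) auto
qed

text \<open>With \<open>a = d\<^sup>2 mod M\<close> and \<open>2 * h = i\<close> modulo \<open>M\<close>, the term \<open>a + i * d\<close> is congruent to
  \<open>(d + h)\<^sup>2 - h\<^sup>2\<close>, which for fixed \<open>i\<close> lies in a translate of the squares.\<close>
lemma covers_squares:
  assumes "odd M"
  obtains S where "finite S" "card S \<le> k\<^sup>2 * card (squares_mod M)" "covers k M S"
proof
  have M: "M > 0" using assms by (auto intro: Nat.gr0I)
  \<comment> \<open>For odd \<open>M\<close>, \<open>(M + 1) / 2\<close> is the inverse of 2, so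
    \<open>h i\<close> represents \<open>i / 2\<close> modulo \<open>M\<close>.\<close>
  define h where "h i = int i * ((int M + 1) div 2)" for i
  have h: "[2 * h i = int i] (mod int M)" for i
  proof -
    have "2 * ((int M + 1) div 2) = int M + 1" using assms by (auto elim!: oddE)
    then have "2 * h i = int i * (int M + 1)"
      unfolding h_def by (metis mult.left_commute)
    then show ?thesis by (simp add: cong_iff_dvd_diff algebra_simps)
  qed
  \<comment> \<open>The index \<open>i\<close> fixes the translate of the squares, and
    \<open>j\<close> the block of length \<open>M\<close> holding the actual integer. All terms lie
    between 0 and \<open>k * M\<close>, so \<open>k\<close> blocks suffice; this accounts for the
    factor \<open>k\<^sup>2\<close>.\<close>
  define T where "T i j = (\<lambda>s. (s - (h i)\<^sup>2) mod int M + int j * int M) ` squares_mod M" for i j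
  define S where "S = (\<Union>i<k. \<Union>j<k. T i j)"
  show "finite S" using M by (auto simp: S_def T_def)
  have "card S \<le> (\<Sum>i<k. \<Sum>j<k. card (T i j))"
    unfolding S_def by (rule order.trans[OF card_UN_le sum_mono]) (auto intro: card_UN_le)
  also have "\<dots> \<le> (\<Sum>i<k. \<Sum>j<k. card (squares_mod M))"
    using M by (intro sum_mono) (auto simp: T_def intro: card_image_le)
  also have "\<dots> = k\<^sup>2 * card (squares_mod M)" by (simp add: power2_eq_square)
  finally show "card S \<le> k\<^sup>2 * card (squares_mod M)" .
  show "covers k M S"
    unfolding covers_def
  proof (intro allI impI exI subsetI)
    fix d x assume d: "d < M" and "x \<in> arith_prog k ((int d)\<^sup>2 mod int M) (int d)"
    then obtain i where i: "i < k" and x: "x = (int d)\<^sup>2 mod int M + int i * int d"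
      by (auto simp: arith_prog_def)
    have x0: "x \<ge> 0" using M by (simp add: x)
    have "int i * int d \<le> int i * int M" using d by (intro mult_left_mono) auto
    moreover have "(int d)\<^sup>2 mod int M < int M" using M by simp
    ultimately have "x < int (i + 1) * int M" unfolding x by (simp add: algebra_simps)
    also have "\<dots> \<le> int k * int M" using i by (intro mult_right_mono) auto
    finally have xk: "x < int k * int M" .
    have "x div int M < int k"
    proof (rule ccontr)
      assume "\<not> x div int M < int k"
      then have "int k * int M \<le> x div int M * int M" by (intro mult_right_mono) auto
      also have "\<dots> \<le> x" using M div_mult_mod_eq[of x "int M"] pos_mod_sign[of "int M" x] by linarith
      finally show False using xk by simp
    qed
    moreover have "x div int M \<ge> 0" using x0 M by (simp add: pos_imp_zdiv_nonneg_iff)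
    moreover define j where "j = nat (x div int M)"
    ultimately have j: "j < k" "x div int M = int j" by auto
    have "[x = (int d)\<^sup>2 + int i * int d] (mod int M)"
      unfolding x by (intro cong_add) auto
    also have "[(int d)\<^sup>2 + int i * int d = (int d)\<^sup>2 + (2 * h i) * int d] (mod int M)"
      using h[of i] by (intro cong_add cong_mult) (auto simp: cong_sym)
    also have "(int d)\<^sup>2 + (2 * h i) * int d = (int d + h i)\<^sup>2 - (h i)\<^sup>2"
      by (simp add: power2_eq_square algebra_simps)
    also have "[(int d + h i)\<^sup>2 - (h i)\<^sup>2 = (int d + h i)\<^sup>2 mod int M - (h i)\<^sup>2] (mod int M)"
      by (intro cong_diff) (auto simp: cong_def)
    finally have "x mod int M = ((int d + h i)\<^sup>2 mod int M - (h i)\<^sup>2) mod int M"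
      by (simp add: cong_def)
    moreover have "x = x mod int M + int j * int M" using j by (metis mod_div_mult_eq)
    ultimately have "x = ((int d + h i)\<^sup>2 mod int M - (h i)\<^sup>2) mod int M + int j * int M"
      by simp
    then have "x \<in> T i j" by (auto simp: T_def squares_mod_def)
    then show "x \<in> S" using i j by (auto simp: S_def)
  qed
qed

section \<open>Base expansion and the passage to the limit superior\<close>

text \<open>Adding, term by term, a progression of difference \<open>d mod B\<close> and
  \<open>B\<close> times one of difference \<open>d div B\<close> gives a progression of difference
  \<open>d\<close>. Hence ranges and cardinality bounds multiply.\<close>

lemma covers_power:
  assumes "finite S" "covers k B S" "B > 0"
  shows "\<exists>S'. finite S' \<and> card S' \<le> card S ^ j \<and> covers k (B ^ j) S'"
proof (induction j)
  case 0
  \<comment> \<open>Only the difference 0 lies below \<open>B ^ 0\<close>, and its progression is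
    constant.\<close>
  show ?case
    by (intro exI[of _ "{0}"]) (auto simp: covers_def arith_prog_def intro!: exI[of _ 0])
next
  case (Suc j)
  then obtain S' where S': "finite S'" "card S' \<le> card S ^ j" "covers k (B ^ j) S'" by blast
  define f where "f = (\<lambda>(x, y). x + int B * y)"
  define S2 where "S2 = f ` (S \<times> S')"
  have "finite S2" using assms S' by (simp add: S2_def)
  moreover have "card S2 \<le> card (S \<times> S')"
    unfolding S2_def using assms S' by (intro card_image_le) auto
  then have "card S2 \<le> card S ^ Suc j"
    using S'(2) by (simp add: card_cartesian_product) (meson le_trans mult_le_mono2)
  moreover have "covers k (B ^ Suc j) S2"
    unfolding covers_def
  proof (intro allI impI)
    fix d assume d: "d < B ^ Suc j"
    then have "d mod B < B" "d div B < B ^ j"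
      using assms(3) by (auto simp: less_mult_imp_div_less mult.commute)
    then obtain a b where a: "arith_prog k a (int (d mod B)) \<subseteq> S"
        and b: "arith_prog k b (int (d div B)) \<subseteq> S'"
      using assms(2) S'(3) unfolding covers_def by blast
    have "a + int B * b + int i * int d \<in> S2" if "i < k" for i
    proof -
      have "int d = int (d mod B) + int B * int (d div B)"
        by (metis mod_mult_div_eq of_nat_add of_nat_mult)
      then have "a + int B * b + int i * int d
          = f (a + int i * int (d mod B), b + int i * int (d div B))"
        by (simp add: f_def algebra_simps)
      moreover have "a + int i * int (d mod B) \<in> S" "b + int i * int (d div B) \<in> S'"
        using a b that unfolding arith_prog_def by blast+
      ultimately show ?thesis unfolding S2_def by blast
    qed
    then show "\<exists>a. arith_prog k a (int d) \<subseteq> S2"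
      by (auto simp: arith_prog_def intro!: exI[of _ "a + int B * b"])
  qed
  ultimately show ?case by blast
qed

text \<open>For \<open>N\<close> between consecutive powers \<open>B ^ j\<close> and
  \<open>B ^ (j + 1)\<close>, the digit construction costs at most \<open>card S ^ (j + 1)\<close>.
  The one surplus factor \<open>card S\<close> is negligible on the scale of
  \<open>ln N\<close>.\<close>

lemma limsup_ln_F_le:
  assumes "finite S" "covers k B S" "B > 1" "k > 0"
  shows "limsup (\<lambda>N. ereal (ln (real (F k N)) / ln (real N))) \<le> ereal (ln (card S) / ln B)"
proof -
  define m where "m = card S"
  have "S \<noteq> {}" using covers_nonempty[OF assms(2)] assms(3,4) by simp
  then have m: "m \<ge> 1" using assms(1) by (simp add: m_def Suc_le_eq card_gt_0_iff)
  have bound: "ln (real (F k N)) / ln (real N) \<le> ln m / ln B + ln m / ln N" if N: "N \<ge> 2" for N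
  proof -
    obtain j where j: "B ^ j \<le> N" "N < B ^ (j + 1)"
      using ex_power_ivl1[of B N] assms N by auto
    obtain S' where S': "finite S'" "card S' \<le> m ^ (j + 1)" "covers k (B ^ (j + 1)) S'"
      using covers_power[OF assms(1,2)] assms(3) m_def by (metis less_imp_le_nat less_trans zero_less_one)
    have le: "F k N \<le> m ^ (j + 1)" using F_le_card[OF S'(1,3) j(2)] S'(2) by linarith
    have "ln (real (F k N)) \<le> (j + 1) * ln m"
    proof (cases "F k N = 0")
      \<comment> \<open>The convention \<open>ln 0 = 0\<close> settles this case.\<close>
      case True
      then show ?thesis using m by simp
    next
      case False
      then have "ln (real (F k N)) \<le> ln (real (m ^ (j + 1)))"
        using of_nat_mono[OF le, where 'a = real] by (intro ln_mono) auto
      also have "\<dots> = (j + 1) * ln m"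
        unfolding of_nat_power by (rule ln_realpow)
      finally show ?thesis .
    qed
    moreover have "j * ln B \<le> ln N"
    proof -
      have "j * ln B = ln (real (B ^ j))" using assms(3) by (simp add: ln_realpow)
      also have "\<dots> \<le> ln N" using j(1) N assms(3) by (subst ln_le_cancel_iff) (auto simp del: of_nat_power)
      finally show ?thesis .
    qed
    then have "j \<le> ln N / ln B" using assms(3) by (simp add: field_simps)
    then have "(j + 1) * ln m \<le> (ln N / ln B + 1) * ln m"
      using m by (intro mult_right_mono) auto
    ultimately have "ln (real (F k N)) \<le> (ln N / ln B + 1) * ln m" by linarith
    then have "ln (real (F k N)) / ln N \<le> (ln N / ln B + 1) * ln m / ln N"
      using N by (intro divide_right_mono) auto
    also have "\<dots> = ln m / ln B + ln m / ln N" using N by (simp add: field_simps)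
    finally show ?thesis .
  qed
  have "(\<lambda>N::nat. ln m / ln (real N)) \<longlonglongrightarrow> 0"
    by (intro real_tendsto_divide_at_top[OF tendsto_const]
        filterlim_compose[OF ln_at_top filterlim_real_sequentially])
  from tendsto_add[OF tendsto_const this, of "ln m / ln B"]
  have "(\<lambda>N::nat. ln m / ln B + ln m / ln (real N)) \<longlonglongrightarrow> ln m / ln B" by simp
  then have lim: "limsup (\<lambda>N. ereal (ln m / ln B + ln m / ln (real N))) = ereal (ln m / ln B)"
    by (intro lim_imp_Limsup) auto
  have "limsup (\<lambda>N. ereal (ln (real (F k N)) / ln (real N)))
      \<le> limsup (\<lambda>N. ereal (ln m / ln B + ln m / ln (real N)))"
    by (intro Limsup_mono eventually_mono[OF eventually_ge_at_top[of 2]]) (use bound in auto)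
  then show ?thesis using lim by (simp add: m_def)
qed

section \<open>Choice of the modulus and of the constants\<close>

text \<open>The modulus is the product of all \<open>r\<close> odd primes up to
  \<open>4 ^ t\<close>. The squares save \<open>r * ln (3 / 2)\<close> in
  \<open>ln (card S)\<close>; the hypothesis on \<open>k\<close> lets \<open>k\<^sup>2\<close>
  consume at most half of it. Dividing the rest by \<open>ln M \<le> r * t * ln 4\<close> cancels
  \<open>r\<close>.\<close>

lemma limsup_ln_F_le_of_scale:
  assumes "t \<ge> 3" "k > 0" "24 * ln (real k) \<le> 2 ^ t"
  shows "limsup (\<lambda>N. ereal (ln (real (F k N)) / ln (real N)))
    \<le> ereal (1 - ln (3 / 2) / (2 * ln 4) / real t)"
proof -
  define P where "P = {p. prime p \<and> odd p \<and> p \<le> (4::nat) ^ t}"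
  define r where "r = card P"
  define M where "M = \<Prod>P"
  have [simp]: "finite P" by (auto simp: P_def)
  have r: "2 ^ (t - 1) \<le> r" using card_odd_primes_ge[OF assms(1)] by (simp add: r_def P_def)
  have "(2::nat) ^ t = 2 * 2 ^ (t - 1)" using assms(1) by (cases t) auto
  then have "2 ^ t \<le> 2 * r" using r by linarith
  then have "(2::real) ^ t \<le> 2 * real r"
    by (metis (mono_tags) of_nat_le_iff of_nat_mult of_nat_numeral of_nat_power)
  then have kr: "12 * ln (real k) \<le> real r" using assms(3) by linarith
  have r1: "r \<ge> 1" using r by (meson le_trans one_le_numeral one_le_power)
  have Ppos: "1 \<le> p" if "p \<in> P" for p using that by (auto simp: P_def Suc_le_eq prime_gt_0_nat)
  have M0: "M > 0" unfolding M_def using Ppos by (intro prod_pos) force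
  have oddM: "odd M" unfolding M_def by (auto simp: even_prod_iff P_def)
  have M1: "M > 1"
  proof -
    obtain p where "p \<in> P" using r1 by (metis r_def card.empty ex_in_conv not_one_le_zero)
    then have "p dvd M" "prime p" by (auto simp: M_def P_def)
    then have "p \<le> M" "p \<ge> 2" using M0 dvd_imp_le prime_ge_2_nat by blast+
    then show ?thesis by linarith
  qed
  have "M \<le> (\<Prod>p\<in>P. 4 ^ t)" unfolding M_def by (intro prod_mono) (auto simp: P_def)
  then have "M \<le> (4 ^ t) ^ r" by (simp add: r_def)
  then have "real M \<le> (4 ^ t) ^ r"
    by (metis of_nat_le_iff of_nat_numeral of_nat_power)
  then have "ln M \<le> ln ((4 ^ t) ^ r)" using M0 by (subst ln_le_cancel_iff) auto
  also have "\<dots> = r * t * ln 4" by (simp add: ln_realpow)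
  finally have lnM: "ln M \<le> r * t * ln 4" .
  obtain S where S: "finite S" "card S \<le> k\<^sup>2 * card (squares_mod M)" "covers k M S"
    using covers_squares[OF oddM] by blast
  have "S \<noteq> {}" using covers_nonempty[OF S(3) M0 assms(2)] .
  then have cS: "card S > 0" using S(1) by (simp add: card_gt_0_iff)
  have "3 ^ r * card (squares_mod M) \<le> 2 ^ r * M"
    unfolding M_def r_def by (rule card_squares_mod_prod_le) (auto simp: P_def)
  then have "k\<^sup>2 * (3 ^ r * card (squares_mod M)) \<le> k\<^sup>2 * (2 ^ r * M)" by (rule mult_le_mono2)
  moreover have "3 ^ r * card S \<le> 3 ^ r * (k\<^sup>2 * card (squares_mod M))"
    using S(2) by (rule mult_le_mono2)
  ultimately have "3 ^ r * card S \<le> k\<^sup>2 * (2 ^ r * M)" by (simp only: mult.left_commute)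
  then have "real (3 ^ r * card S) \<le> real (k\<^sup>2 * (2 ^ r * M))" by (simp only: of_nat_le_iff)
  then have "ln (real (3 ^ r * card S)) \<le> ln (real (k\<^sup>2 * (2 ^ r * M)))"
    using cS M0 assms(2) by (subst ln_le_cancel_iff) (auto simp del: of_nat_power)
  then have "r * ln 3 + ln (card S) \<le> 2 * ln k + (r * ln 2 + ln M)"
    using cS M0 assms(2) by (simp add: ln_mult ln_realpow)
  then have "ln (card S) \<le> 2 * ln k + ln M - r * ln (3 / 2)"
    by (simp add: ln_div algebra_simps)
  \<comment> \<open>The value 1/3 matches the constant 12 in \<open>kr\<close>:
    \<open>2 * ln k \<le> r / 6\<close>, which is at most half of
    \<open>r * ln (3 / 2)\<close>.\<close>
  moreover have "ln (3 / 2 :: real) \<ge> 1 / 3"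
  proof -
    have "exp (1 / 3 :: real) \<le> 3 / 2"
      using exp_bound[of "1 / 3"] by (simp add: power2_eq_square)
    then show ?thesis by (subst ln_ge_iff) auto
  qed
  then have "2 * ln k \<le> r * (ln (3 / 2) / 2)"
    using kr mult_left_mono[of "1 / 3" "ln (3 / 2)" "real r"] by simp
  ultimately have main: "ln (card S) \<le> ln M - r * (ln (3 / 2) / 2)" by simp
  have lM: "ln M > 0" using M1 by simp
  have "ln (3 / 2) / (2 * ln 4) / real t * ln M \<le> ln (3 / 2) / (2 * ln 4) / real t * (r * t * ln 4)"
    using lnM by (intro mult_left_mono) auto
  also have "\<dots> = r * (ln (3 / 2) / 2)" using assms(1) by (simp add: field_simps)
  finally have "ln (card S) \<le> (1 - ln (3 / 2) / (2 * ln 4) / real t) * ln M"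
    using main unfolding left_diff_distrib mult_1 by linarith
  then have "ln (card S) / ln M \<le> 1 - ln (3 / 2) / (2 * ln 4) / real t"
    using lM by (simp add: pos_divide_le_eq)
  then show ?thesis
    using limsup_ln_F_le[OF S(1,3) M1 assms(2)] by (meson ereal_less_eq(3) order_trans)
qed

theorem theorem1p7:
  "\<exists>c::real. c > 0 \<and>
     (\<forall>k::nat. k \<ge> 3 \<longrightarrow>
        limsup (\<lambda>N::nat. ereal (ln (real (F k N)) / ln (real N)))
          \<le> ereal (1 - c / ln (ln (real k))))"
proof -
  \<comment> \<open>A strict bound \<open>exp 1 < 3\<close> makes \<open>ln (ln k)\<close> positive
    from \<open>k = 3\<close> on. Applying \<open>exp_bound\<close> at 1 would only give
    \<open>exp 1 \<le> 3\<close>, hence the detour through the fourth root.\<close>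
  have "exp (1 / 4 :: real) \<le> 21 / 16" using exp_bound[of "1 / 4"] by (simp add: power2_eq_square)
  then have "exp (1 / 4 :: real) ^ 4 \<le> (21 / 16) ^ 4" by (intro power_mono) auto
  also have "exp (1 / 4 :: real) ^ 4 = exp 1" by (simp add: exp_of_nat_mult[symmetric])
  also have "(21 / 16 :: real) ^ 4 < 3" by (simp add: power4_eq_xxxx)
  finally have "ln (3::real) > 1" using ln_less_cancel_iff[of "exp 1" 3] by simp
  then have l3: "ln (ln (3::real)) > 0" by simp
  \<comment> \<open>Chosen so that \<open>t \<le> A * ln (ln k)\<close> for every
    \<open>k \<ge> 3\<close>, with \<open>t\<close> as defined below.\<close>
  define A where "A = (1 + ln 48 / ln (ln 3)) / ln (2::real)"
  define b where "b = ln (3 / 2) / (2 * ln (4::real))"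
  have b: "b > 0" by (simp add: b_def)
  have A: "A > 0" using l3 by (auto simp: A_def intro!: divide_pos_pos add_pos_pos)
  show ?thesis
  proof (intro exI[of _ "b / A"] conjI allI impI)
    show "b / A > 0" using A b by simp
    fix k :: nat assume k: "k \<ge> 3"
    have lk3: "ln (real k) \<ge> ln 3" using k by simp
    then have lk: "ln (real k) > 1" using \<open>ln 3 > 1\<close> by linarith
    have llk: "ln (ln (real k)) \<ge> ln (ln 3)" using lk3 \<open>ln 3 > 1\<close> by simp
    \<comment> \<open>The least exponent with \<open>24 * ln k \<le> 2 ^ t\<close>.\<close>
    define t where "t = nat \<lceil>log 2 (24 * ln k)\<rceil>"
    have "log 2 (24 * ln k) \<ge> log 2 (2 ^ 3)"
      using lk by (intro Transcendental.log_mono) auto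
    then have l: "log 2 (24 * ln k) \<ge> 3" by (subst (asm) log_pow_cancel) auto
    have t: "log 2 (24 * ln k) \<le> t" "t \<le> log 2 (24 * ln k) + 1" "t \<ge> 3"
      unfolding t_def using l by linarith+
    have "24 * ln k = 2 powr (log 2 (24 * ln k))" using lk by simp
    also have "\<dots> \<le> 2 powr t" using t by simp
    finally have "24 * ln k \<le> 2 ^ t" by (simp add: powr_realpow)
    then have "limsup (\<lambda>N::nat. ereal (ln (real (F k N)) / ln (real N))) \<le> ereal (1 - b / t)"
      using limsup_ln_F_le_of_scale[OF t(3)] k by (simp add: b_def)
    moreover have "b / A / ln (ln k) \<le> b / t"
    proof -
      \<comment> \<open>Rounding up costs at most 1, which doubles 24 to 48.\<close>
      have "t \<le> log 2 (24 * ln k) + log 2 2" using t by simp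
      also have "\<dots> = log 2 (48 * ln k)" using lk log_mult[of 2 "24 * ln k" 2] by simp
      also have "\<dots> = (ln (ln k) + ln 48) / ln 2" using lk by (simp add: log_def ln_mult)
      \<comment> \<open>The constant \<open>ln 48\<close> is absorbed because
        \<open>ln (ln k) / ln (ln 3) \<ge> 1\<close>.\<close>
      also have "\<dots> \<le> (ln (ln k) + ln 48 / ln (ln 3) * ln (ln k)) / ln 2"
        using llk l3 by (intro divide_right_mono add_left_mono) (auto simp: field_simps)
      also have "\<dots> = A * ln (ln k)" by (simp add: A_def field_simps)
      finally have "t \<le> A * ln (ln k)" .
      then have "b / (A * ln (ln k)) \<le> b / t"
        using b t(3) by (intro divide_left_mono) auto
      then show ?thesis by simp
    qed
    ultimately show "limsup (\<lambda>N::nat. ereal (ln (real (F k N)) / ln (real N)))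
        \<le> ereal (1 - b / A / ln (ln (real k)))"
      by (meson ereal_less_eq(3) order_trans diff_left_mono)
  qed
qed

end
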